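(* For every formula $A$: if there exists a closed proof table for $\{\mathbf{F_l}A\}$ in the calculus $\mathbf{D_1}$, then $A$ is valid in Dummett logic, i.e. $\rho\Vdash A$ for every linearly ordered Kripke model $\langle P,\leq,\rho,\Vdash\rangle$.
   Context: Formulas are built from propositional variables and $\top,\bot$ using $\land,\lor,\to$. A model is $\langle P,\leq,\rho,\Vdash\rangle$ with $\langle P,\leq\rangle$ a linear order with minimum $\rho$, forcing on atoms upward persistent, $\top$ always and $\bot$ never forced, extended as usual ($\alpha\Vdash A\to B$ iff for all $\beta\geq\alpha$, $\beta\Vdash A$ implies $\beta\Vdash B$). Signed formulas use signs $\mathbf{T},\mathbf{F},\mathbf{F_l},\mathbf{F_n},\mathbf{T_n},\widehat{\mathbf{T}},\widetilde{\mathbf{T}}$ (realizability: $\mathbf{T}A$: $\alpha\Vdash A$; $\mathbf{F}A$: $\alpha\not\Vdash A$; $\mathbf{F_n}A$: some $\beta>\alpha$ with $\beta\not\Vdash A$; $\mathbf{T_n}A$: all $\beta>\alpha$ force $A$; $\mathbf{F_l}A$: $\mathbf{F}A$ and $\mathbf{T_n}A$; $\widetilde{\mathbf{T}}(B\to C)$: $\alpha\Vdash B\to C$ and $\mathbf{F_n}B$; $\widehat{\mathbf{T}}(B\to C)$: $\alpha\Vdash B\to C$ and $\alpha\not\Vdash B$). Rules of $\mathbf{D_1}$ (premise / conclusions, $S$ a set of signed formulas, the displayed formulas of a premise not belonging to $S$): ($\mathbf{T}\land$) $S,\mathbf{T}(A\land B)$ / $S,\mathbf{T}A,\mathbf{T}B$;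 ($\mathbf{F_l}\land$) $S,\mathbf{F_l}(A\land B)$ / $S,\mathbf{F_l}A,\mathbf{T_n}B\mid S,\mathbf{T}A,\mathbf{F_l}B$; ($\mathbf{T}\lor$) $S,\mathbf{T}(A\lor B)$ / $S,\mathbf{T}A\mid S,\mathbf{T}B$; ($\mathbf{F_l}\lor$) $S,\mathbf{F_l}(A\lor B)$ / $S,\mathbf{F}A,\mathbf{F_l}B\mid S,\mathbf{F}B,\mathbf{F_l}A$; ($\mathbf{T}\to$) $S,\mathbf{T}(A\to B)$ / $S,\mathbf{T}B\mid S,\mathbf{F_l}A,\mathbf{T_n}B\mid S,\widetilde{\mathbf{T}}(A\to B)$; ($\mathbf{F_l}\to$) $S,\mathbf{F_l}(A\to B)$ / $S,\mathbf{T}A,\mathbf{F_l}B$; ($\mathbf{F}$-decide) $S,\mathbf{F}A$ / $S,\mathbf{F_l}A\mid S,\mathbf{F_n}A$; ($\widehat{\mathbf{T}}$-decide) $S,\widehat{\mathbf{T}}(A\to B)$ / $S,\mathbf{F_l}A,\mathbf{T_n}B\mid S,\widetilde{\mathbf{T}}(A\to B)$; ($\mathbf{F_n}\widetilde{\mathbf{T}}$) $S,\widetilde{\mathbf{T}}(A_1\to B_1),\dots,\widetilde{\mathbf{T}}(A_n\to B_n),\mathbf{F_n}C_{n+1},\dots,\mathbf{F_n}C_u$ / $S_c,V_1,S_{\mathbf F}\mid\dots\mid S_c,V_n,S_{\mathbf F}\mid S_c,S_{\widehat{\mathbf T}},V_{n+1}\mid\dots\mid S_c,S_{\widehat{\mathbf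 T}},V_u$, with $S_{\mathbf F}=\{\mathbf{F}C_{n+1},\dots,\mathbf{F}C_u\}$, $S_{\widehat{\mathbf T}}=\{\widehat{\mathbf{T}}(A_i\to B_i):1\le i\le n\}$, $V_j=\{\widehat{\mathbf{T}}(A_i\to B_i):i\ne j,i\le n\}\cup\{\mathbf{F_l}A_j,\mathbf{T_n}B_j\}$ for $j\le n$, $V_j=\{\mathbf{F}C_i:i\ne j,n<i\le u\}\cup\{\mathbf{F_l}C_j\}$ for $n<j\le u$, and $S_c=\{\mathbf{T}A:\mathbf{T}A\in S\}\cup\{\mathbf{T}A:\mathbf{F_l}A\in S\}\cup\{\mathbf{T}A:\mathbf{T_n}A\in S\}$. A set is inconsistent if it contains $\mathbf{T}\bot$, or both $\mathbf{T}A$ and $\mathbf{F}A$, or both $\mathbf{T}A$ and $\mathbf{F_l}A$. A proof table for a set $S$ is a tree rooted at $S$ obtained by successive applications of the rules; it is closed if all its leaves are inconsistent sets. *)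

theory Defs
  imports Main
begin

datatype 'v form =
    Atom 'v
  | Top
  | Bot
  | Conj "'v form" "'v form"  (infixr "\<^bold>\<and>" 55)
  | Disj "'v form" "'v form"  (infixr "\<^bold>\<or>" 50)
  | Imp "'v form" "'v form"  (infixr "\<^bold>\<rightarrow>" 45)

locale linear_kripke_model =
  fixes P :: "'w set" and le :: "'w rel" and \<rho> :: 'w and V :: "'w \<Rightarrow> 'v \<Rightarrow> bool"
  assumes linear: "linear_order_on P le"
    and root_in: "\<rho> \<in> P"
    and root_least: "\<And>\<alpha>. \<alpha> \<in> P \<Longrightarrow> (\<rho>, \<alpha>) \<in> le"
    and persistent: "\<And>\<alpha> \<beta> p. (\<alpha>, \<beta>) \<in> le \<Longrightarrow> V \<alpha> p \<Longrightarrow> V \<beta> p"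

primrec forces :: "'w set \<Rightarrow> 'w rel \<Rightarrow> ('w \<Rightarrow> 'v \<Rightarrow> bool) \<Rightarrow> 'w \<Rightarrow> 'v form \<Rightarrow> bool" where
  "forces P le V \<alpha> (Atom p) \<longleftrightarrow> V \<alpha> p"
| "forces P le V \<alpha> Top \<longleftrightarrow> True"
| "forces P le V \<alpha> Bot \<longleftrightarrow> False"
| "forces P le V \<alpha> (A \<^bold>\<and> B) \<longleftrightarrow> forces P le V \<alpha> A \<and> forces P le V \<alpha> B"
| "forces P le V \<alpha> (A \<^bold>\<or> B) \<longleftrightarrow> forces P le V \<alpha> A \<or> forces P le V \<alpha> B"
| "forces P le V \<alpha> (A \<^bold>\<rightarrow> B) \<longleftrightarrow>
     (\<forall>\<beta>\<in>P. (\<alpha>, \<beta>) \<in> le \<longrightarrow> forces P le V \<beta> A \<longrightarrow> forces P le V \<beta> B)"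

text \<open>
  \<open>That\<close> and \<open>Ttilde\<close> are the signs written as T with a hat and T with a tilde. They are
  meaningful for implications only, and the rules below use them only there.
\<close>

datatype 'v sform =
    T "'v form"
  | F "'v form"
  | Fl "'v form"
  | Fn "'v form"
  | Tn "'v form"
  | That "'v form"
  | Ttilde "'v form"

definition S_c :: "'v sform set \<Rightarrow> 'v sform set" where
  "S_c S = {T A | A. T A \<in> S} \<union> {T A | A. Fl A \<in> S} \<union> {T A | A. Tn A \<in> S}"

text \<open>
  In the rule for \<open>Fn\<close> and \<open>Ttilde\<close> the displayed formulas are given by two lists: \<open>Is\<close> holds the
  pairs \<open>(A\<^sub>1, B\<^sub>1), \<dots>, (A\<^sub>n, B\<^sub>n)\<close> and \<open>Cs\<close> holds \<open>C\<^bsub>n+1\<^esub>, \<dots>, C\<^sub>u\<close>. Both are indexed from 0.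
\<close>

definition displayed :: "('v form \<times> 'v form) list \<Rightarrow> 'v form list \<Rightarrow> 'v sform set" where
  "displayed Is Cs = {Ttilde (A \<^bold>\<rightarrow> B) | A B. (A, B) \<in> set Is} \<union> {Fn C | C. C \<in> set Cs}"

definition S_F :: "'v form list \<Rightarrow> 'v sform set" where
  "S_F Cs = {F C | C. C \<in> set Cs}"

definition S_That :: "('v form \<times> 'v form) list \<Rightarrow> 'v sform set" where
  "S_That Is = {That (A \<^bold>\<rightarrow> B) | A B. (A, B) \<in> set Is}"

definition V_imp :: "('v form \<times> 'v form) list \<Rightarrow> nat \<Rightarrow> 'v sform set" where
  "V_imp Is j =
     {That (fst (Is ! i) \<^bold>\<rightarrow> snd (Is ! i)) | i. i < length Is \<and> i \<noteq> j}
     \<union> {Fl (fst (Is ! j)), Tn (snd (Is ! j))}"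

definition V_F :: "'v form list \<Rightarrow> nat \<Rightarrow> 'v sform set" where
  "V_F Cs j = {F (Cs ! i) | i. i < length Cs \<and> i \<noteq> j} \<union> {Fl (Cs ! j)}"

text \<open>
  \<open>d1_rule S Ss\<close>: the list \<open>Ss\<close> of conclusions is obtained from the premise \<open>S\<close> by one rule
  application. In the last rule at least one formula must be displayed, so every application has a
  conclusion; \<open>S\<close> itself may contain further \<open>Fn\<close> and \<open>Ttilde\<close> formulas, which \<open>S_c\<close> discards.
\<close>

inductive d1_rule :: "'v sform set \<Rightarrow> 'v sform set list \<Rightarrow> bool" where
  T_conj: "T (A \<^bold>\<and> B) \<notin> S \<Longrightarrow>
     d1_rule (S \<union> {T (A \<^bold>\<and> B)}) [S \<union> {T A, T B}]"
| Fl_conj: "Fl (A \<^bold>\<and> B) \<notin> S \<Longrightarrow>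
     d1_rule (S \<union> {Fl (A \<^bold>\<and> B)}) [S \<union> {Fl A, Tn B}, S \<union> {T A, Fl B}]"
| T_disj: "T (A \<^bold>\<or> B) \<notin> S \<Longrightarrow>
     d1_rule (S \<union> {T (A \<^bold>\<or> B)}) [S \<union> {T A}, S \<union> {T B}]"
| Fl_disj: "Fl (A \<^bold>\<or> B) \<notin> S \<Longrightarrow>
     d1_rule (S \<union> {Fl (A \<^bold>\<or> B)}) [S \<union> {F A, Fl B}, S \<union> {F B, Fl A}]"
| T_imp: "T (A \<^bold>\<rightarrow> B) \<notin> S \<Longrightarrow>
     d1_rule (S \<union> {T (A \<^bold>\<rightarrow> B)}) [S \<union> {T B}, S \<union> {Fl A, Tn B}, S \<union> {Ttilde (A \<^bold>\<rightarrow> B)}]"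
| Fl_imp: "Fl (A \<^bold>\<rightarrow> B) \<notin> S \<Longrightarrow>
     d1_rule (S \<union> {Fl (A \<^bold>\<rightarrow> B)}) [S \<union> {T A, Fl B}]"
| F_decide: "F A \<notin> S \<Longrightarrow>
     d1_rule (S \<union> {F A}) [S \<union> {Fl A}, S \<union> {Fn A}]"
| That_decide: "That (A \<^bold>\<rightarrow> B) \<notin> S \<Longrightarrow>
     d1_rule (S \<union> {That (A \<^bold>\<rightarrow> B)}) [S \<union> {Fl A, Tn B}, S \<union> {Ttilde (A \<^bold>\<rightarrow> B)}]"
| Fn_Ttilde: "\<lbrakk>distinct Is; distinct Cs; Is \<noteq> [] \<or> Cs \<noteq> []; S \<inter> displayed Is Cs = {}\<rbrakk> \<Longrightarrow>
     d1_rule (S \<union> displayed Is Cs)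
       (map (\<lambda>j. S_c S \<union> V_imp Is j \<union> S_F Cs) [0..<length Is]
        @ map (\<lambda>j. S_c S \<union> S_That Is \<union> V_F Cs j) [0..<length Cs])"

definition inconsistent :: "'v sform set \<Rightarrow> bool" where
  "inconsistent S \<longleftrightarrow>
     T Bot \<in> S \<or> (\<exists>A. T A \<in> S \<and> F A \<in> S) \<or> (\<exists>A. T A \<in> S \<and> Fl A \<in> S)"

datatype 'v table = Node (root: "'v sform set") (children: "'v table list")

inductive is_proof_table :: "'v table \<Rightarrow> bool" where
  leaf: "is_proof_table (Node S [])"
| step: "\<lbrakk>d1_rule S (map root ts); \<forall>t\<in>set ts. is_proof_table t\<rbrakk> \<Longrightarrow> is_proof_table (Node S ts)"

definition proof_table_for :: "'v sform set \<Rightarrow> 'v table \<Rightarrow> bool" where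
  "proof_table_for S t \<longleftrightarrow> is_proof_table t \<and> root t = S"

fun leaves :: "'v table \<Rightarrow> 'v sform set set" where
  "leaves (Node S ts) = (if ts = [] then {S} else (\<Union>t\<in>set ts. leaves t))"

definition closed_table :: "'v table \<Rightarrow> bool" where
  "closed_table t \<longleftrightarrow> (\<forall>S\<in>leaves t. inconsistent S)"

end

(* D1 is sound for finite chains only: in an infinite chain a refuted formula need not have a last
   refuting world, so Fl A may be unrealizable although A fails. Hence filtration first: a
   countermodel is restricted to its root and one world for each set of forced subformulas. In a
   finite chain every rule passes realizability from the premise to some conclusion; for the
   Fn-Ttilde rule one moves to the earliest of the last worlds refuting the displayed formulas.
   The last world refuting A realizes Fl A, whereas the leaves of a closed table are unrealizable. *)

theory Submission
  imports Defs
begin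

text \<open>Serves twice: for \<open>le\<close> it picks the earliest of finitely many worlds, for
  the converse of \<open>le\<close> the latest.\<close>

lemma linear_order_on_finite_least:
  assumes "linear_order_on P r" "finite X" "X \<noteq> {}" "X \<subseteq> P"
  shows "\<exists>m\<in>X. \<forall>x\<in>X. (m, x) \<in> r"
  using assms(2-4)
proof (induction X rule: finite_ne_induct)
  case (singleton x)
  then show ?case
    using assms(1) by (auto simp: order_on_defs refl_on_def)
next
  case (insert x X)
  then obtain m where m: "m \<in> X" "\<forall>y\<in>X. (m, y) \<in> r"
    by auto
  have refl: "(x, x) \<in> r" and tr: "trans r" and cmp: "(x, m) \<in> r \<or> (m, x) \<in> r"
    using assms(1) insert.prems m(1)
    by (cases "x = m"; auto simp: order_on_defs refl_on_def total_on_def)+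
  from cmp show ?case
  proof
    assume "(x, m) \<in> r"
    then have "\<forall>y\<in>insert x X. (x, y) \<in> r"
      using refl m(2) transD[OF tr] by blast
    then show ?thesis
      by blast
  qed (use m in blast)
qed

section \<open>Realizability of signed formulas\<close>

context linear_kripke_model
begin

lemma le_refl: "\<alpha> \<in> P \<Longrightarrow> (\<alpha>, \<alpha>) \<in> le"
  using linear by (auto simp: order_on_defs refl_on_def)

lemma le_trans: "(\<alpha>, \<beta>) \<in> le \<Longrightarrow> (\<beta>, \<gamma>) \<in> le \<Longrightarrow> (\<alpha>, \<gamma>) \<in> le"
  using linear by (auto simp: order_on_defs dest: transD)

lemma le_antisym: "(\<alpha>, \<beta>) \<in> le \<Longrightarrow> (\<beta>, \<alpha>) \<in> le \<Longrightarrow> \<alpha> = \<beta>"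
  using linear by (auto simp: order_on_defs dest: antisymD)

lemma le_linear: "\<alpha> \<in> P \<Longrightarrow> \<beta> \<in> P \<Longrightarrow> (\<alpha>, \<beta>) \<in> le \<or> (\<beta>, \<alpha>) \<in> le"
  using linear le_refl by (cases "\<alpha> = \<beta>") (auto simp: order_on_defs total_on_def)

lemma forces_mono: "(\<alpha>, \<beta>) \<in> le \<Longrightarrow> forces P le V \<alpha> A \<Longrightarrow> forces P le V \<beta> A"
  by (induction A) (auto intro: persistent le_trans)

text \<open>The signs \<open>That\<close> and \<open>Ttilde\<close> accept any formula, so their
  clauses demand an implication; on other formulas they are never realized.\<close>

primrec realizes where
  "realizes \<alpha> (T A) \<longleftrightarrow> forces P le V \<alpha> A"
| "realizes \<alpha> (F A) \<longleftrightarrow> \<not> forces P le V \<alpha> A"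
| "realizes \<alpha> (Fl A) \<longleftrightarrow> \<not> forces P le V \<alpha> A \<and>
     (\<forall>\<beta>\<in>P. (\<alpha>, \<beta>) \<in> le \<longrightarrow> \<beta> \<noteq> \<alpha> \<longrightarrow> forces P le V \<beta> A)"
| "realizes \<alpha> (Fn A) \<longleftrightarrow> (\<exists>\<beta>\<in>P. (\<alpha>, \<beta>) \<in> le \<and> \<beta> \<noteq> \<alpha> \<and> \<not> forces P le V \<beta> A)"
| "realizes \<alpha> (Tn A) \<longleftrightarrow> (\<forall>\<beta>\<in>P. (\<alpha>, \<beta>) \<in> le \<longrightarrow> \<beta> \<noteq> \<alpha> \<longrightarrow> forces P le V \<beta> A)"
| "realizes \<alpha> (That A) \<longleftrightarrow> (\<exists>B C. A = (B \<^bold>\<rightarrow> C) \<and> forces P le V \<alpha> A \<and> \<not> forces P le V \<alpha> B)"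
| "realizes \<alpha> (Ttilde A) \<longleftrightarrow> (\<exists>B C. A = (B \<^bold>\<rightarrow> C) \<and> forces P le V \<alpha> A \<and>
     (\<exists>\<beta>\<in>P. (\<alpha>, \<beta>) \<in> le \<and> \<beta> \<noteq> \<alpha> \<and> \<not> forces P le V \<beta> B))"

text \<open>\<open>T\<close> persists upward, while \<open>Fl\<close> and \<open>Tn\<close> both
  promise forcing at all strictly later worlds; hence the need for \<beta> to differ from
  \<alpha>.\<close>

lemma realizes_S_c:
  assumes "\<forall>\<phi>\<in>S. realizes \<alpha> \<phi>" "\<beta> \<in> P" "(\<alpha>, \<beta>) \<in> le" "\<beta> \<noteq> \<alpha>"
  shows "\<forall>\<phi>\<in>S_c S. realizes \<beta> \<phi>"
  using assms forces_mono by (fastforce simp: S_c_def)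

lemma inconsistent_not_realized:
  "inconsistent S \<Longrightarrow> \<exists>\<phi>\<in>S. \<not> realizes \<alpha> \<phi>"
  unfolding inconsistent_def by (metis forces.simps(3) realizes.simps(1-3))

section \<open>Last refuting worlds in a finite chain\<close>

text \<open>The equivalence makes the refuting worlds exactly the initial segment ending at \<beta>;
  by reflexivity \<beta> itself refutes \<open>A\<close>.\<close>

definition last_refuting where
  "last_refuting \<beta> A \<longleftrightarrow> \<beta> \<in> P \<and> (\<forall>\<gamma>\<in>P. forces P le V \<gamma> A \<longleftrightarrow> (\<gamma>, \<beta>) \<notin> le)"

lemma ex_last_refuting:
  assumes "finite P" "\<alpha> \<in> P" "\<not> forces P le V \<alpha> A"
  obtains \<beta> where "last_refuting \<beta> A"
proof -
  let ?X = "{\<gamma> \<in> P. \<not> forces P le V \<gamma> A}"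
  have "linear_order_on P (le\<inverse>)"
    using linear by simp
  then obtain \<beta> where "\<beta> \<in> ?X" "\<forall>\<gamma>\<in>?X. (\<beta>, \<gamma>) \<in> le\<inverse>"
    using linear_order_on_finite_least[of P "le\<inverse>" ?X] assms by auto
  then have "last_refuting \<beta> A"
    using forces_mono by (auto simp: last_refuting_def)
  then show thesis ..
qed

lemma last_refuting_Fl: "last_refuting \<beta> A \<Longrightarrow> realizes \<beta> (Fl A)"
  using le_refl le_antisym by (auto simp: last_refuting_def)

text \<open>Each formula in \<open>Xs\<close> has a last refuting world \<open>l A\<close> beyond
  \<alpha>. The earliest of these lies in the refuting initial segment of every other formula, so
  all of \<open>Xs\<close> is refuted there.\<close>

lemma earliest_last_refuting:
  assumes fin: "finite P" and "finite Xs" "Xs \<noteq> {}"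
    and refuted: "\<And>A. A \<in> Xs \<Longrightarrow> realizes \<alpha> (Fn A)"
  obtains \<beta> A where "A \<in> Xs" "last_refuting \<beta> A" "(\<alpha>, \<beta>) \<in> le" "\<beta> \<noteq> \<alpha>"
    "\<And>B. B \<in> Xs \<Longrightarrow> \<not> forces P le V \<beta> B"
proof -
  have "\<forall>A\<in>Xs. \<exists>\<beta>. last_refuting \<beta> A \<and> (\<alpha>, \<beta>) \<in> le \<and> \<beta> \<noteq> \<alpha>"
  proof
    fix A assume "A \<in> Xs"
    then obtain \<gamma> where \<gamma>: "\<gamma> \<in> P" "(\<alpha>, \<gamma>) \<in> le" "\<gamma> \<noteq> \<alpha>" "\<not> forces P le V \<gamma> A"
      using refuted by fastforce
    then obtain \<beta> where \<beta>: "last_refuting \<beta> A"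
      using ex_last_refuting fin by blast
    then have "(\<gamma>, \<beta>) \<in> le"
      using \<gamma> by (auto simp: last_refuting_def)
    \<comment> \<open>Equality of \<beta> and \<alpha> would squeeze \<gamma> between them and force
      \<gamma> to be \<alpha>.\<close>
    then show "\<exists>\<beta>. last_refuting \<beta> A \<and> (\<alpha>, \<beta>) \<in> le \<and> \<beta> \<noteq> \<alpha>"
      using \<beta> \<gamma> le_trans le_antisym by blast
  qed
  then obtain l where l: "\<And>A. A \<in> Xs \<Longrightarrow> last_refuting (l A) A \<and> (\<alpha>, l A) \<in> le \<and> l A \<noteq> \<alpha>"
    by metis
  have "l ` Xs \<subseteq> P"
    using l by (auto simp: last_refuting_def)
  then obtain A where A: "A \<in> Xs" "\<forall>B\<in>Xs. (l A, l B) \<in> le"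
    using linear_order_on_finite_least[OF linear, of "l ` Xs"] assms(2,3) by auto
  show thesis
  proof (rule that[OF A(1)])
    show "last_refuting (l A) A" "(\<alpha>, l A) \<in> le" "l A \<noteq> \<alpha>"
      using l A(1) by auto
    show "\<not> forces P le V (l A) B" if "B \<in> Xs" for B
      using l A that unfolding last_refuting_def by blast
  qed
qed

section \<open>Soundness of the rules in a finite chain\<close>

lemma That_realized:
  "(\<alpha>, \<beta>) \<in> le \<Longrightarrow> realizes \<alpha> (Ttilde (A \<^bold>\<rightarrow> B)) \<Longrightarrow> \<not> forces P le V \<beta> A \<Longrightarrow>
    realizes \<beta> (That (A \<^bold>\<rightarrow> B))"
  using forces_mono[of \<alpha> \<beta> "A \<^bold>\<rightarrow> B"] by auto

text \<open>Each \<open>Ttilde\<close> contains an \<open>Fn\<close> of its antecedent, so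
  antecedents and \<open>Cs\<close> can be treated alike. The formula \<open>X\<close> whose last
  refuting world comes first selects the conclusion: it gets \<open>Fl\<close>, while the others,
  merely refuted there, yield \<open>That\<close> or \<open>F\<close>.\<close>

lemma Fn_Ttilde_realized:
  assumes fin: "finite P" and ne: "Is \<noteq> [] \<or> Cs \<noteq> []"
    and real: "\<forall>\<phi>\<in>S \<union> displayed Is Cs. realizes \<alpha> \<phi>"
  shows "\<exists>S'\<in>set (map (\<lambda>j. S_c S \<union> V_imp Is j \<union> S_F Cs) [0..<length Is]
            @ map (\<lambda>j. S_c S \<union> S_That Is \<union> V_F Cs j) [0..<length Cs]).
          \<exists>\<beta>\<in>P. \<forall>\<phi>\<in>S'. realizes \<beta> \<phi>"
proof -
  let ?Xs = "fst ` set Is \<union> set Cs"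
  have imp: "realizes \<alpha> (Ttilde (fst p \<^bold>\<rightarrow> snd p))" if "p \<in> set Is" for p
  proof -
    have "Ttilde (fst p \<^bold>\<rightarrow> snd p) \<in> displayed Is Cs"
      using that by (cases p) (auto simp: displayed_def)
    then show ?thesis
      using real by blast
  qed
  have Fn: "realizes \<alpha> (Fn A)" if "A \<in> ?Xs" for A
    using that
  proof
    assume "A \<in> fst ` set Is"
    then show ?thesis
      using imp by auto
  next
    assume "A \<in> set Cs"
    then show ?thesis
      using real unfolding displayed_def by blast
  qed
  obtain \<beta> X where X: "X \<in> ?Xs" "last_refuting \<beta> X" and \<beta>: "(\<alpha>, \<beta>) \<in> le" "\<beta> \<noteq> \<alpha>"
    and ref: "\<And>B. B \<in> ?Xs \<Longrightarrow> \<not> forces P le V \<beta> B"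
  proof (rule earliest_last_refuting[OF fin _ _ Fn])
    show "finite ?Xs" "?Xs \<noteq> {}"
      using ne by auto
  qed (blast intro: that)+
  have \<beta>P: "\<beta> \<in> P"
    using X(2) by (simp add: last_refuting_def)
  have S_c: "\<forall>\<phi>\<in>S_c S. realizes \<beta> \<phi>"
    using realizes_S_c[of S \<alpha> \<beta>] real \<beta> \<beta>P by blast
  have F: "realizes \<beta> (F C)" if "C \<in> set Cs" for C
    using ref that by simp
  have That: "realizes \<beta> (That (fst p \<^bold>\<rightarrow> snd p))" if "p \<in> set Is" for p
    by (rule That_realized[OF \<beta>(1) imp[OF that]]) (use ref that in auto)
  have Fl: "realizes \<beta> (Fl X)"
    using X(2) by (rule last_refuting_Fl)
  from X(1) show ?thesis
  proof
    assume "X \<in> fst ` set Is"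
    then obtain j where j: "j < length Is" "X = fst (Is ! j)"
      by (auto simp: in_set_conv_nth)
    \<comment> \<open>The implication holds at \<beta> by \<open>That\<close>, and its antecedent
      holds strictly above \<beta> by \<open>Fl\<close>.\<close>
    have "realizes \<beta> (Tn (snd (Is ! j)))"
      using Fl That[of "Is ! j"] j by auto
    then have "\<forall>\<phi>\<in>V_imp Is j. realizes \<beta> \<phi>"
      using Fl That j unfolding V_imp_def by (auto simp del: realizes.simps)
    moreover have "\<forall>\<phi>\<in>S_F Cs. realizes \<beta> \<phi>"
      using F unfolding S_F_def by blast
    ultimately have "\<forall>\<phi>\<in>S_c S \<union> V_imp Is j \<union> S_F Cs. realizes \<beta> \<phi>"
      using S_c by blast
    then show ?thesis
      using j(1) \<beta>P by (intro bexI[of _ "S_c S \<union> V_imp Is j \<union> S_F Cs"]) auto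
  next
    assume "X \<in> set Cs"
    then obtain j where j: "j < length Cs" "X = Cs ! j"
      by (auto simp: in_set_conv_nth)
    have "\<forall>\<phi>\<in>V_F Cs j. realizes \<beta> \<phi>"
      using Fl F j unfolding V_F_def by (auto simp del: realizes.simps)
    moreover have "\<forall>\<phi>\<in>S_That Is. realizes \<beta> \<phi>"
      using That unfolding S_That_def by force
    ultimately have "\<forall>\<phi>\<in>S_c S \<union> S_That Is \<union> V_F Cs j. realizes \<beta> \<phi>"
      using S_c by blast
    then show ?thesis
      using j(1) \<beta>P by (intro bexI[of _ "S_c S \<union> S_That Is \<union> V_F Cs j"]) auto
  qed
qed

text \<open>The realizing world moves only for \<open>Fn_Ttilde\<close>, where finiteness enters;
  every other rule is a case distinction at \<alpha>.\<close>

lemma d1_rule_sound: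
  assumes "finite P" "d1_rule S Ss" "\<alpha> \<in> P" "\<forall>\<phi>\<in>S. realizes \<alpha> \<phi>"
  shows "\<exists>S'\<in>set Ss. \<exists>\<beta>\<in>P. \<forall>\<phi>\<in>S'. realizes \<beta> \<phi>"
  using assms(2,4)
proof (cases rule: d1_rule.cases)
  case (Fl_imp A B S)
  then have "\<not> forces P le V \<alpha> (A \<^bold>\<rightarrow> B)"
    and above: "\<And>\<gamma>. \<gamma> \<in> P \<Longrightarrow> (\<alpha>, \<gamma>) \<in> le \<Longrightarrow> \<gamma> \<noteq> \<alpha> \<Longrightarrow> forces P le V \<gamma> (A \<^bold>\<rightarrow> B)"
    using assms(4) by auto
  then obtain \<beta> where \<beta>: "\<beta> \<in> P" "(\<alpha>, \<beta>) \<in> le" "forces P le V \<beta> A" "\<not> forces P le V \<beta> B"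
    by auto
  \<comment> \<open>A strictly later \<beta> would force the implication, and hence
    \<open>B\<close>.\<close>
  have "\<beta> = \<alpha>"
    using \<beta> above[of \<beta>] le_refl by auto
  moreover have "forces P le V \<gamma> B" if "\<gamma> \<in> P" "(\<alpha>, \<gamma>) \<in> le" "\<gamma> \<noteq> \<alpha>" for \<gamma>
    using above[OF that] forces_mono[OF that(2), of A] le_refl that \<beta> \<open>\<beta> = \<alpha>\<close> by auto
  ultimately show ?thesis
    using Fl_imp assms(3,4) \<beta> by auto
next
  case (Fn_Ttilde Is Cs S)
  then show ?thesis
    using Fn_Ttilde_realized[of Is Cs S \<alpha>] assms(1,4) by simp
next
  case (T_imp A B S)
  have "forces P le V \<alpha> (A \<^bold>\<rightarrow> B)" and S: "\<forall>\<phi>\<in>S. realizes \<alpha> \<phi>"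
    using T_imp assms(4) by auto
  \<comment> \<open>If \<open>A\<close> holds at \<alpha>, so does \<open>B\<close>. Otherwise
    \<open>A\<close> either fails again strictly above, giving \<open>Ttilde\<close>, or holds
    everywhere there and brings \<open>B\<close> with it.\<close>
  then have "realizes \<alpha> (T B) \<or> realizes \<alpha> (Fl A) \<and> realizes \<alpha> (Tn B) \<or> realizes \<alpha> (Ttilde (A \<^bold>\<rightarrow> B))"
    using le_refl[OF assms(3)] assms(3) by auto
  then show ?thesis
    unfolding T_imp(2) using S assms(3) by (auto simp del: realizes.simps)
next
  case (Fl_conj A B S)
  then have "realizes \<alpha> (Fl A) \<and> realizes \<alpha> (Tn B) \<or> realizes \<alpha> (T A) \<and> realizes \<alpha> (Fl B)"
    and S: "\<forall>\<phi>\<in>S. realizes \<alpha> \<phi>"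
    using assms(4) by auto
  then show ?thesis
    unfolding Fl_conj(2) using assms(3) by (auto simp del: realizes.simps)
next
  case (Fl_disj A B S)
  have S: "\<forall>\<phi>\<in>S. realizes \<alpha> \<phi>" and Fl: "realizes \<alpha> (Fl (A \<^bold>\<or> B))"
    using Fl_disj assms(4) by auto
  \<comment> \<open>Linearity decides: if one later world refutes \<open>A\<close> and another
    refutes \<open>B\<close>, each forces the other disjunct, and by persistence the later of the
    two forces both.\<close>
  have "realizes \<alpha> (Tn A) \<or> realizes \<alpha> (Tn B)"
  proof (rule ccontr)
    assume "\<not> ?thesis"
    then obtain \<beta> \<gamma> where \<beta>\<gamma>: "\<beta> \<in> P" "(\<alpha>, \<beta>) \<in> le" "\<beta> \<noteq> \<alpha>" "\<not> forces P le V \<beta> A"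
      "\<gamma> \<in> P" "(\<alpha>, \<gamma>) \<in> le" "\<gamma> \<noteq> \<alpha>" "\<not> forces P le V \<gamma> B"
      by auto
    then have "forces P le V \<beta> B" "forces P le V \<gamma> A"
      using Fl by auto
    then show False
      using le_linear[of \<beta> \<gamma>] forces_mono \<beta>\<gamma> by blast
  qed
  then have "realizes \<alpha> (F A) \<and> realizes \<alpha> (Fl B) \<or> realizes \<alpha> (F B) \<and> realizes \<alpha> (Fl A)"
    using Fl by auto
  then show ?thesis
    unfolding Fl_disj(2) using S assms(3) by (auto simp del: realizes.simps)
next
  case (That_decide A B S)
  have "forces P le V \<alpha> (A \<^bold>\<rightarrow> B)" "\<not> forces P le V \<alpha> A" and S: "\<forall>\<phi>\<in>S. realizes \<alpha> \<phi>"
    using That_decide assms(4) by auto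
  then have "realizes \<alpha> (Fl A) \<and> realizes \<alpha> (Tn B) \<or> realizes \<alpha> (Ttilde (A \<^bold>\<rightarrow> B))"
    by auto
  then show ?thesis
    unfolding That_decide(2) using S assms(3) by (auto simp del: realizes.simps)
qed (use assms(3) in auto)

section \<open>Closed tables over finite chains\<close>

text \<open>A realized root would pass realizability down some branch to an inconsistent leaf. The
  world stays arbitrary in the induction because a rule may change it.\<close>

lemma closed_table_not_realized:
  assumes "finite P" "is_proof_table t" "closed_table t" "\<alpha> \<in> P"
  shows "\<exists>\<phi>\<in>root t. \<not> realizes \<alpha> \<phi>"
  using assms(2-4)
proof (induction arbitrary: \<alpha>)
  case (leaf S)
  then show ?case
    using inconsistent_not_realized by (auto simp: closed_table_def)
next
  case (step S ts)
  show ?case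
  proof (rule ccontr)
    assume "\<not> ?thesis"
    then obtain t \<beta> where t: "t \<in> set ts" "\<beta> \<in> P" "\<forall>\<phi>\<in>root t. realizes \<beta> \<phi>"
      using d1_rule_sound[OF assms(1) step.hyps(1) step.prems(2)] by auto
    then have "closed_table t"
      using step.prems(1) by (auto simp: closed_table_def split: if_splits)
    then show False
      using step.IH t by blast
  qed
qed

lemma closed_table_valid_finite:
  assumes "finite P" "proof_table_for {Fl A} t" "closed_table t" "\<alpha> \<in> P"
  shows "forces P le V \<alpha> A"
proof (rule ccontr)
  assume "\<not> ?thesis"
  then obtain \<beta> where "last_refuting \<beta> A"
    using ex_last_refuting assms by blast
  then show False
    using closed_table_not_realized[of t \<beta>] last_refuting_Fl[of \<beta> A] assms
    by (auto simp: proof_table_for_def last_refuting_def)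
qed

end

section \<open>Filtration to a finite chain\<close>

primrec subformulas where
  "subformulas (Atom p) = {Atom p}"
| "subformulas Top = {Top}"
| "subformulas Bot = {Bot}"
| "subformulas (A \<^bold>\<and> B) = insert (A \<^bold>\<and> B) (subformulas A \<union> subformulas B)"
| "subformulas (A \<^bold>\<or> B) = insert (A \<^bold>\<or> B) (subformulas A \<union> subformulas B)"
| "subformulas (A \<^bold>\<rightarrow> B) = insert (A \<^bold>\<rightarrow> B) (subformulas A \<union> subformulas B)"

lemma finite_subformulas: "finite (subformulas A)"
  by (induction A) auto

lemma self_in_subformulas: "A \<in> subformulas A"
  by (induction A) auto

context linear_kripke_model
begin

definition theory_on where
  "theory_on \<Sigma> \<alpha> = {B \<in> \<Sigma>. forces P le V \<alpha> B}"

text \<open>Only implication matters: a failure at a discarded world is copied to its representative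
  in \<open>Q\<close>. Representatives may be chosen freely, since in a chain one on the wrong side
  of \<alpha> does no harm.\<close>

lemma forces_restrict:
  assumes "Q \<subseteq> P" and rep: "\<And>\<beta>. \<beta> \<in> P \<Longrightarrow> \<exists>\<gamma>\<in>Q. theory_on \<Sigma> \<gamma> = theory_on \<Sigma> \<beta>"
    and "subformulas A \<subseteq> \<Sigma>" "\<alpha> \<in> Q"
  shows "forces Q (Restr le Q) V \<alpha> A \<longleftrightarrow> forces P le V \<alpha> A"
  using assms(3,4)
proof (induction A arbitrary: \<alpha>)
  case (Imp A B)
  have IH: "forces Q (Restr le Q) V \<gamma> A \<longleftrightarrow> forces P le V \<gamma> A"
    "forces Q (Restr le Q) V \<gamma> B \<longleftrightarrow> forces P le V \<gamma> B" if "\<gamma> \<in> Q" for \<gamma>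
    using Imp that by auto
  have \<Sigma>: "A \<in> \<Sigma>" "B \<in> \<Sigma>"
    using Imp.prems(1) self_in_subformulas by auto
  have "\<exists>\<gamma>\<in>Q. (\<alpha>, \<gamma>) \<in> le \<and> forces P le V \<gamma> A \<and> \<not> forces P le V \<gamma> B"
    if \<beta>: "\<beta> \<in> P" "(\<alpha>, \<beta>) \<in> le" "forces P le V \<beta> A" "\<not> forces P le V \<beta> B" for \<beta>
  proof -
    obtain \<gamma> where \<gamma>: "\<gamma> \<in> Q" "theory_on \<Sigma> \<gamma> = theory_on \<Sigma> \<beta>"
      using rep \<beta>(1) by blast
    then have AB: "forces P le V \<gamma> A" "\<not> forces P le V \<gamma> B"
      using \<Sigma> \<beta>(3,4) by (auto simp: theory_on_def)
    show ?thesis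
    proof (cases "(\<alpha>, \<gamma>) \<in> le")
      case False
      \<comment> \<open>Then \<open>\<alpha>\<close> lies between \<open>\<gamma>\<close> and \<open>\<beta>\<close>, so \<open>\<alpha>\<close> itself forces \<open>A\<close> and not \<open>B\<close>.\<close>
      then have "(\<gamma>, \<alpha>) \<in> le"
        using le_linear \<gamma>(1) Imp.prems(2) assms(1) by blast
      then have "forces P le V \<alpha> A" "\<not> forces P le V \<alpha> B"
        using AB(1) \<beta>(2,4) forces_mono by blast+
      then show ?thesis
        using le_refl Imp.prems(2) assms(1) by blast
    qed (use \<gamma>(1) AB in blast)
  qed
  then have "(\<forall>\<gamma>\<in>Q. (\<alpha>, \<gamma>) \<in> le \<longrightarrow> forces P le V \<gamma> A \<longrightarrow> forces P le V \<gamma> B) \<longleftrightarrow>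
      forces P le V \<alpha> (A \<^bold>\<rightarrow> B)"
    using assms(1) unfolding forces.simps by blast
  then show ?case
    using IH Imp.prems(2) by simp
qed auto

text \<open>A finite \<Sigma> has finitely many subsets, so finitely many worlds exhaust the
  theories.\<close>

lemma finite_filtration:
  assumes "finite \<Sigma>"
  obtains Q where "finite Q" "\<rho> \<in> Q" "Q \<subseteq> P"
    "\<And>\<beta>. \<beta> \<in> P \<Longrightarrow> \<exists>\<gamma>\<in>Q. theory_on \<Sigma> \<gamma> = theory_on \<Sigma> \<beta>"
proof -
  have "theory_on \<Sigma> ` P \<subseteq> Pow \<Sigma>"
    by (auto simp: theory_on_def)
  then have "finite (theory_on \<Sigma> ` P)"
    using assms finite_subset by blast
  then obtain Q where "finite Q" "Q \<subseteq> P" "theory_on \<Sigma> ` P = theory_on \<Sigma> ` Q"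
    using finite_subset_image[of "theory_on \<Sigma> ` P" "theory_on \<Sigma>" P] by auto
  \<comment> \<open>The root is added by hand, so that the restricted chain keeps \<rho> as its
    minimum.\<close>
  moreover have "\<exists>\<gamma>\<in>insert \<rho> Q. theory_on \<Sigma> \<gamma> = theory_on \<Sigma> \<beta>" if "\<beta> \<in> P" for \<beta>
  proof -
    have "theory_on \<Sigma> \<beta> \<in> theory_on \<Sigma> ` Q"
      using \<open>theory_on \<Sigma> ` P = theory_on \<Sigma> ` Q\<close> that by blast
    then show ?thesis
      by auto
  qed
  ultimately show thesis
    using that[of "insert \<rho> Q"] root_in by simp
qed

lemma restrict_model:
  assumes "\<rho> \<in> Q" "Q \<subseteq> P"
  shows "linear_kripke_model Q (Restr le Q) \<rho> V"
proof
  have "refl_on Q (Restr le Q)"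
    using assms(2) le_refl by (auto simp: refl_on_def)
  moreover have "trans (Restr le Q)"
    using le_trans by (intro transI) blast
  moreover have "antisym (Restr le Q)"
    using le_antisym by (intro antisymI) blast
  moreover have "total_on Q (Restr le Q)"
    using le_linear assms(2) unfolding total_on_def by blast
  ultimately show "linear_order_on Q (Restr le Q)"
    by (auto simp: order_on_defs)
  show "V \<beta> p" if "(\<alpha>, \<beta>) \<in> Restr le Q" "V \<alpha> p" for \<alpha> \<beta> p
    using that persistent by blast
qed (use assms root_least in auto)

end

theorem theorem1:
  fixes A :: "'v form"
    and P :: "'w set" and le :: "'w rel" and \<rho> :: 'w and V :: "'w \<Rightarrow> 'v \<Rightarrow> bool"
  assumes "\<exists>t. proof_table_for {Fl A} t \<and> closed_table t"
    and "linear_kripke_model P le \<rho> V"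
  shows "forces P le V \<rho> A"
proof -
  interpret linear_kripke_model P le \<rho> V by fact
  obtain t where t: "proof_table_for {Fl A} t" "closed_table t"
    using assms(1) by blast
  obtain Q where Q: "finite Q" "\<rho> \<in> Q" "Q \<subseteq> P"
    "\<And>\<beta>. \<beta> \<in> P \<Longrightarrow> \<exists>\<gamma>\<in>Q. theory_on (subformulas A) \<gamma> = theory_on (subformulas A) \<beta>"
    using finite_filtration[OF finite_subformulas] by metis
  \<comment> \<open>The second interpretation makes the results on finite chains available for the
    filtered model.\<close>
  interpret Q: linear_kripke_model Q "Restr le Q" \<rho> V
    using Q(2,3) by (rule restrict_model)
  have "forces Q (Restr le Q) V \<rho> A"
    using Q.closed_table_valid_finite Q(1,2) t by blast
  then show ?thesis
    using forces_restrict[OF Q(3) Q(4) subset_refl Q(2)] by blast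
qed

end
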